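(* For integers $n,j\ge 0$, let $p_{od,e}(n,j)$ be the number of partitions $\lambda$ of $n$ in which no odd part is repeated and which have exactly $j$ even parts (counted with multiplicity) greater than $\mathrm{meex}(\lambda)$. Let $p_{4,e}(n,j)$ be the number of partitions of $n$ in which every even part is a multiple of $4$ and which have exactly $j$ even parts (counted with multiplicity). Then $p_{od,e}(n,j)=p_{4,e}(n,j)$.
   Context: For a partition $\lambda$, $\mathrm{meex}(\lambda)$ is the smallest positive even integer that is not a part of $\lambda$. In partitions in which no odd part is repeated, even parts may appear with any multiplicity. In the partitions counted by $p_{4,e}(n,j)$, odd parts are unrestricted and may be repeated. *)

theory Defs
  imports "HOL-Library.Multiset"
begin

definition is_partition :: "nat multiset \<Rightarrow> nat \<Rightarrow> bool" where
  "is_partition M n \<longleftrightarrow> 0 \<notin># M \<and> sum_mset M = n"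

definition meex :: "nat multiset \<Rightarrow> nat" where
  "meex M = (LEAST k. 0 < k \<and> even k \<and> k \<notin># M)"

definition p_od_e :: "nat \<Rightarrow> nat \<Rightarrow> nat" where
  "p_od_e n j = card {M. is_partition M n \<and>
     (\<forall>x. odd x \<longrightarrow> count M x \<le> 1) \<and>
     size {#x \<in># M. even x \<and> meex M < x#} = j}"

definition p_4_e :: "nat \<Rightarrow> nat \<Rightarrow> nat" where
  "p_4_e n j = card {M. is_partition M n \<and>
     (\<forall>x. x \<in># M \<longrightarrow> even x \<longrightarrow> 4 dvd x) \<and>
     size {#x \<in># M. even x#} = j}"

text \<open>Since \<open>card\<close> is \<open>0\<close> on infinite sets, the two counts are meaningful only
  because a number has finitely many partitions; and the \<open>LEAST\<close> above is always attained.\<close>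

lemma finite_partitions: "finite {M. is_partition M n}"
proof -
  have "{M. is_partition M n} \<subseteq> mset ` {xs. set xs \<subseteq> {..n} \<and> length xs \<le> n}"
  proof
    fix M assume "M \<in> {M. is_partition M n}"
    then have nz: "0 \<notin># M" and s: "sum_mset M = n" by (auto simp: is_partition_def)
    obtain xs where xs: "M = mset xs" by (metis ex_mset)
    have sl: "sum_list xs = n" using s xs by (simp add: sum_mset_sum_list)
    have "set xs \<subseteq> {..n}" unfolding sl[symmetric] by (auto intro: member_le_sum_list)
    moreover have "length xs \<le> sum_list xs" using nz unfolding xs
      by (induction xs) auto
    ultimately show "M \<in> mset ` {xs. set xs \<subseteq> {..n} \<and> length xs \<le> n}" using xs sl by auto
  qed
  then show ?thesis
    by (rule finite_subset) (simp add: finite_lists_length_le)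
qed

lemma meex_props: "0 < meex M \<and> even (meex M) \<and> meex M \<notin># M"
proof -
  define k where "k = 2 * Suc (sum_mset M)"
  have "k \<notin># M"
  proof
    assume "k \<in># M"
    then have "sum_mset M = k + sum_mset (M - {#k#})" by (rule sum_mset.remove)
    then show False by (simp add: k_def)
  qed
  then have "0 < k \<and> even k \<and> k \<notin># M" by (simp add: k_def)
  then show ?thesis unfolding meex_def by (rule LeastI)
qed

end

theory Submission
  imports Defs
begin

text \<open>
  Halve the even parts of a partition without repeated odd parts and conjugate the result. If
  \<open>\<nu>\<close> is the conjugate of \<open>\<mu>\<close>, then the number of parts of \<open>\<mu>\<close> exceeding its least missing
  positive integer is the largest repeated part of \<open>\<nu>\<close> (\<open>0\<close> if \<open>\<nu>\<close> has distinct parts). Writing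
  every multiplicity of \<open>\<nu>\<close> as \<open>2 q + r\<close> with \<open>r \<in> {0, 1}\<close> splits \<open>\<nu>\<close> into a partition with
  distinct parts and two copies of a partition whose largest part is this number \<open>j\<close>; conjugating
  the latter gives a partition with exactly \<open>j\<close> parts. Hence \<open>p_od_e n j\<close> counts pairs
  \<open>(\<delta>, \<pi>)\<close> with \<open>\<delta>\<close> a partition into distinct parts, \<open>\<pi>\<close> a partition into \<open>j\<close> parts and
  \<open>|\<delta>| + 4 |\<pi>| = n\<close>. By Euler's theorem \<open>\<delta>\<close> may be taken with odd parts instead, and adjoining
  the parts of \<open>\<pi>\<close>, multiplied by \<open>4\<close>, gives \<open>p_4_e n j\<close>.
\<close>

section \<open>Conjugation\<close>

text \<open>For \<open>k > 0\<close> this is the length of column \<open>k\<close> of the Ferrers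
  diagram, that is, the \<open>k\<close>-th largest part of the conjugate.\<close>

definition num_ge :: "nat multiset \<Rightarrow> nat \<Rightarrow> nat" where
  "num_ge M k = size {#x \<in># M. k \<le> x#}"

text \<open>Indexing by the nonempty columns only keeps the index set finite and keeps
  \<open>0\<close> from becoming a part.\<close>

definition conj_part :: "nat multiset \<Rightarrow> nat multiset" where
  "conj_part M = image_mset (num_ge M) (mset_set {k. 0 < k \<and> 0 < num_ge M k})"

lemma num_ge_empty [simp]: "num_ge {#} k = 0"
  by (simp add: num_ge_def)

lemma num_ge_add_mset [simp]: "num_ge (add_mset x M) k = num_ge M k + (if k \<le> x then 1 else 0)"
  by (simp add: num_ge_def)

lemma num_ge_Suc: "num_ge M k = num_ge M (Suc k) + count M k"
  by (induction M) auto

lemma num_ge_antimono: "k \<le> l \<Longrightarrow> num_ge M l \<le> num_ge M k"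
  by (induction M) auto

lemma num_ge_1: "0 \<notin># M \<Longrightarrow> num_ge M 1 = size M"
  by (induction M) auto

lemma num_ge_eq_0: "(\<And>x. x \<in># M \<Longrightarrow> x < k) \<Longrightarrow> num_ge M k = 0"
  by (induction M) (auto simp: not_le)

lemma le_sum_mset: "x \<in># M \<Longrightarrow> x \<le> sum_mset M" for x :: nat
  by (induction M) auto

lemma num_ge_support: "0 < num_ge M k \<Longrightarrow> k \<le> sum_mset M"
  by (rule ccontr) (use num_ge_eq_0[of M k] le_sum_mset[of _ M] in fastforce)

lemma finite_num_ge: "0 < i \<Longrightarrow> finite {k. 0 < k \<and> i \<le> num_ge M k}"
  by (rule finite_subset[of _ "{..sum_mset M}"]) (auto intro!: num_ge_support[of M])

lemma finite_num_ge_pos: "finite {k. 0 < k \<and> 0 < num_ge M k}"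
  using finite_num_ge[of 1 M] by (simp add: Suc_le_eq)

text \<open>Multiplicities are differences of consecutive values of \<open>num_ge\<close>, so the
  values at positive indices fix every multiplicity except that of \<open>0\<close>.\<close>

lemma positive_mset_eqI:
  assumes "0 \<notin># M" "0 \<notin># N" "\<And>k. 0 < k \<Longrightarrow> num_ge M k = num_ge N k"
  shows "M = N"
proof (rule multiset_eqI)
  fix x
  show "count M x = count N x"
  proof (cases "x = 0")
    case True
    then show ?thesis using assms(1,2) by (simp add: not_in_iff)
  next
    case False
    then show ?thesis
      using num_ge_Suc[of M x] num_ge_Suc[of N x] assms(3)[of x] assms(3)[of "Suc x"] by simp
  qed
qed

lemma zero_notin_conj_part [simp]: "0 \<notin># conj_part M"
  by (auto simp: conj_part_def finite_num_ge_pos)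

lemma num_ge_conj_part:
  assumes "0 < i"
  shows "num_ge (conj_part M) i = card {k. 0 < k \<and> i \<le> num_ge M k}"
proof -
  have "{k \<in> {k. 0 < k \<and> 0 < num_ge M k}. i \<le> num_ge M k} = {k. 0 < k \<and> i \<le> num_ge M k}"
    using assms by auto
  then have "{#k \<in># mset_set {k. 0 < k \<and> 0 < num_ge M k}. i \<le> num_ge M k#}
      = mset_set {k. 0 < k \<and> i \<le> num_ge M k}"
    by (simp only: filter_mset_mset_set[OF finite_num_ge_pos])
  then show ?thesis
    unfolding num_ge_def[of "conj_part M"] by (simp add: conj_part_def filter_mset_image_mset)
qed

text \<open>Difference of \<open>num_ge_conj_part\<close> at \<open>i\<close> and
  \<open>Suc i\<close>. Positivity of \<open>i\<close> keeps the set finite, as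
  \<open>num_ge M k\<close> is \<open>0\<close> for all large \<open>k\<close>.\<close>

lemma count_conj_part:
  assumes "0 < i"
  shows "count (conj_part M) i = card {k. 0 < k \<and> num_ge M k = i}"
proof -
  have eq: "{k. 0 < k \<and> i \<le> num_ge M k}
      = {k. 0 < k \<and> num_ge M k = i} \<union> {k. 0 < k \<and> Suc i \<le> num_ge M k}"
    by auto
  have "finite {k. 0 < k \<and> num_ge M k = i}"
    by (rule finite_subset[OF _ finite_num_ge[OF assms, of M]]) auto
  then have "card {k. 0 < k \<and> i \<le> num_ge M k}
      = card {k. 0 < k \<and> num_ge M k = i} + card {k. 0 < k \<and> Suc i \<le> num_ge M k}"
    unfolding eq by (intro card_Un_disjoint finite_num_ge) auto
  then show ?thesis
    using num_ge_Suc[of "conj_part M" i] assms by (simp add: num_ge_conj_part)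
qed

text \<open>Since \<open>num_ge M\<close> is decreasing, the set is an initial segment of the
  positive integers, so its size is at least \<open>l\<close> exactly when it contains
  \<open>l\<close>. This is the symmetry of the diagram that makes conjugation an
  involution.\<close>

lemma le_card_num_ge_iff:
  assumes "0 < i" "0 < l"
  shows "l \<le> card {k. 0 < k \<and> i \<le> num_ge M k} \<longleftrightarrow> i \<le> num_ge M l"
proof
  assume "i \<le> num_ge M l"
  then have "{1..l} \<subseteq> {k. 0 < k \<and> i \<le> num_ge M k}"
    using num_ge_antimono[of _ l M] by force
  from card_mono[OF finite_num_ge[OF assms(1)] this]
  show "l \<le> card {k. 0 < k \<and> i \<le> num_ge M k}" by simp
next
  assume l: "l \<le> card {k. 0 < k \<and> i \<le> num_ge M k}"
  show "i \<le> num_ge M l"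
  proof (rule ccontr)
    assume "\<not> i \<le> num_ge M l"
    then have "{k. 0 < k \<and> i \<le> num_ge M k} \<subseteq> {1..<l}"
      using num_ge_antimono[of l _ M] by (force simp: not_le)
    from card_mono[OF finite_atLeastLessThan this] l assms show False by simp
  qed
qed

lemma conj_part_conj_part:
  assumes "0 \<notin># M"
  shows "conj_part (conj_part M) = M"
proof (rule positive_mset_eqI)
  fix l :: nat assume "0 < l"
  then have "num_ge (conj_part (conj_part M)) l = card {i. 0 < i \<and> l \<le> num_ge (conj_part M) i}"
    by (rule num_ge_conj_part)
  also have "{i. 0 < i \<and> l \<le> num_ge (conj_part M) i} = {1..num_ge M l}"
    using \<open>0 < l\<close> by (auto simp: num_ge_conj_part le_card_num_ge_iff)
  finally show "num_ge (conj_part (conj_part M)) l = num_ge M l" by simp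
qed (use assms in auto)

text \<open>Double counting: a part \<open>x\<close> is counted once by each \<open>k\<close> in
  \<open>{1..x}\<close>, and the bound \<open>N\<close> loses none of these indices.\<close>

lemma sum_num_ge: "(\<And>x. x \<in># M \<Longrightarrow> x \<le> N) \<Longrightarrow> (\<Sum>k=1..N. num_ge M k) = sum_mset M"
proof (induction M)
  case (add x M)
  have "(\<Sum>k=1..N. if k \<le> x then 1 else 0 :: nat) = card {k \<in> {1..N}. k \<le> x}"
    by (simp add: sum.If_cases Int_def)
  also have "{k \<in> {1..N}. k \<le> x} = {1..x}"
    using add.prems[of x] by auto
  finally show ?case
    using add by (simp add: sum.distrib)
qed simp

lemma sum_mset_conj_part [simp]: "sum_mset (conj_part M) = sum_mset M"
proof -
  have "sum_mset (conj_part M) = (\<Sum>k | 0 < k \<and> 0 < num_ge M k. num_ge M k)"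
    by (simp add: conj_part_def sum_unfold_sum_mset)
  also have "\<dots> = (\<Sum>k=1..sum_mset M. num_ge M k)"
    by (rule sum.mono_neutral_left) (auto dest: num_ge_support)
  also have "\<dots> = sum_mset M"
    by (rule sum_num_ge) (rule le_sum_mset)
  finally show ?thesis .
qed

section \<open>The least missing part and the largest repeated part\<close>

definition least_missing :: "nat multiset \<Rightarrow> nat" where
  "least_missing M = (LEAST k. 0 < k \<and> k \<notin># M)"

definition num_above_missing :: "nat multiset \<Rightarrow> nat" where
  "num_above_missing M = size {#x \<in># M. least_missing M < x#}"

text \<open>For \<open>m > 0\<close>, \<open>j\<close> is the largest part of multiplicity at least \<open>m\<close>, or \<open>0\<close> if there is none.\<close>

definition largest_with_mult :: "nat \<Rightarrow> nat multiset \<Rightarrow> nat \<Rightarrow> bool" where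
  "largest_with_mult m M j \<longleftrightarrow> (\<forall>i>j. count M i < m) \<and> (0 < j \<longrightarrow> m \<le> count M j)"

text \<open>The larger of two different candidates would have multiplicity both at least
  \<open>m\<close> and below \<open>m\<close>. Later, two numbers are identified by showing that
  both have this property.\<close>

lemma largest_with_mult_unique:
  "largest_with_mult m M i \<Longrightarrow> largest_with_mult m M j \<Longrightarrow> i = j"
  unfolding largest_with_mult_def by (metis gr_implies_not0 linorder_neqE_nat not_le bot_nat_0.not_eq_extremum)

lemma least_missing_props: "0 < least_missing M" "least_missing M \<notin># M"
proof -
  have "Suc (sum_mset M) \<notin># M"
    using le_sum_mset by fastforce
  then have "0 < least_missing M \<and> least_missing M \<notin># M"
    unfolding least_missing_def
    using LeastI[of "\<lambda>k. 0 < k \<and> k \<notin># M" "Suc (sum_mset M)"] by simp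
  then show "0 < least_missing M" "least_missing M \<notin># M" by auto
qed

lemma mem_of_less_least_missing: "0 < k \<Longrightarrow> k < least_missing M \<Longrightarrow> k \<in># M"
  unfolding least_missing_def using not_less_Least by blast

text \<open>\<open>num_ge M\<close> agrees at \<open>l\<close> and \<open>Suc l\<close> exactly when
  \<open>l\<close> is not a part of \<open>M\<close>. The first such \<open>l > 0\<close> is the
  least missing integer, where the common value is \<open>num_above_missing M\<close>; by
  monotonicity any later repetition has at most this value.\<close>

lemma largest_repeated_conj_part: "largest_with_mult 2 (conj_part M) (num_above_missing M)"
proof -
  define m where "m = least_missing M"
  define j where "j = num_above_missing M"
  have m: "0 < m" "m \<notin># M" unfolding m_def by (rule least_missing_props)+
  have j1: "num_ge M (Suc m) = j"
    by (simp add: j_def num_above_missing_def num_ge_def m_def Suc_le_eq)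
  then have j0: "num_ge M m = j"
    using num_ge_Suc[of M m] m by (simp add: not_in_iff)
  have distinct_above: "count (conj_part M) i < 2" if i: "j < i" for i
  proof -
    have *: "k \<le> l" if "0 < l" "num_ge M k = i" "num_ge M l = i" for k l
    proof (rule ccontr)
      assume "\<not> k \<le> l"
      then have "num_ge M (Suc l) = num_ge M l"
        using num_ge_antimono[of "Suc l" k M] num_ge_antimono[of l "Suc l" M] that by simp
      then have "l \<notin># M" using num_ge_Suc[of M l] by (simp add: not_in_iff)
      then have "m \<le> l" using mem_of_less_least_missing[of l M] \<open>0 < l\<close> m_def by force
      then show False using num_ge_antimono[of m l M] j0 i that by simp
    qed
    have "card {k. 0 < k \<and> num_ge M k = i} \<le> Suc 0"
      by (rule card_le_Suc0_iff_eq[THEN iffD2])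
        (use i in \<open>auto intro!: le_antisym * finite_subset[OF _ finite_num_ge[of i M]]\<close>)
    then show ?thesis using i by (simp add: count_conj_part)
  qed
  have "2 \<le> count (conj_part M) j" if "0 < j"
  proof -
    have "finite {k. 0 < k \<and> num_ge M k = j}"
      by (rule finite_subset[OF _ finite_num_ge[OF that, of M]]) auto
    then have "card {m, Suc m} \<le> card {k. 0 < k \<and> num_ge M k = j}"
      by (rule card_mono) (use m j0 j1 in auto)
    then show ?thesis using that by (simp add: count_conj_part)
  qed
  then show ?thesis
    using distinct_above by (simp add: largest_with_mult_def j_def)
qed

text \<open>The first column is the longest, and its length \<open>num_ge M 1\<close> is the number
  of parts because \<open>0\<close> is not a part.\<close>

lemma largest_conj_part:
  assumes "0 \<notin># M"
  shows "largest_with_mult 1 (conj_part M) (size M)"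
proof -
  have "count (conj_part M) i = 0" if i: "size M < i" for i
  proof -
    have "num_ge M k \<noteq> i" if "0 < k" for k
      using num_ge_antimono[of 1 k M] num_ge_1[OF assms] i that by simp
    then have "{k. 0 < k \<and> num_ge M k = i} = {}" by blast
    then show ?thesis using i count_conj_part[of i M] by (simp only: card.empty)
  qed
  moreover have "1 \<le> count (conj_part M) (size M)" if s: "0 < size M"
  proof -
    have "finite {k. 0 < k \<and> num_ge M k = size M}"
      by (rule finite_subset[OF _ finite_num_ge[OF s, of M]]) auto
    then have "card {1::nat} \<le> card {k. 0 < k \<and> num_ge M k = size M}"
      by (rule card_mono) (use num_ge_1[OF assms] in auto)
    then show ?thesis using count_conj_part[of "size M" M] s by simp
  qed
  ultimately show ?thesis by (auto simp: largest_with_mult_def)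
qed

section \<open>Splitting multiplicities by parity\<close>

definition distinct_parts :: "nat multiset \<Rightarrow> bool" where
  "distinct_parts M \<longleftrightarrow> (\<forall>x. count M x \<le> 1)"

definition halve_mult :: "nat multiset \<Rightarrow> nat multiset" where
  "halve_mult M = Abs_multiset (\<lambda>x. count M x div 2)"

definition parity_mult :: "nat multiset \<Rightarrow> nat multiset" where
  "parity_mult M = Abs_multiset (\<lambda>x. count M x mod 2)"

lemma count_halve_mult [simp]: "count (halve_mult M) x = count M x div 2"
  unfolding halve_mult_def
  by (subst count_Abs_multiset) (rule finite_subset[OF _ finite_set_mset[of M]], auto intro: count_inI)

lemma count_parity_mult [simp]: "count (parity_mult M) x = count M x mod 2"
  unfolding parity_mult_def
  by (subst count_Abs_multiset) (rule finite_subset[OF _ finite_set_mset[of M]], auto intro: count_inI)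

lemma distinct_parity_mult [simp]: "distinct_parts (parity_mult M)"
  unfolding distinct_parts_def count_parity_mult by (intro allI) presburger

lemma parity_halve_mult: "parity_mult M + halve_mult M + halve_mult M = M"
  by (rule multiset_eqI) (simp, presburger)

lemma count_distinct_parts: "distinct_parts D \<Longrightarrow> count D x = 0 \<or> count D x = 1"
  unfolding distinct_parts_def by (metis One_nat_def le_Suc_eq le_zero_eq)

lemma parity_mult_join:
  assumes "distinct_parts D"
  shows "parity_mult (D + P + P) = D"
proof (rule multiset_eqI)
  fix x show "count (parity_mult (D + P + P)) x = count D x"
    using count_distinct_parts[OF assms, of x] by (simp, presburger)
qed

lemma halve_mult_join:
  assumes "distinct_parts D"
  shows "halve_mult (D + P + P) = P"
proof (rule multiset_eqI)
  fix x show "count (halve_mult (D + P + P)) x = count P x"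
    using count_distinct_parts[OF assms, of x] by (simp, presburger)
qed

lemma zero_notin_halve_mult: "0 \<notin># M \<Longrightarrow> 0 \<notin># halve_mult M"
  by (simp add: not_in_iff)

lemma zero_notin_parity_mult: "0 \<notin># M \<Longrightarrow> 0 \<notin># parity_mult M"
  by (simp add: not_in_iff)

text \<open>A multiplicity has a positive quotient by 2 exactly when it is at least 2.\<close>

lemma largest_halve_mult:
  "largest_with_mult 1 (halve_mult M) j \<longleftrightarrow> largest_with_mult 2 M j"
proof -
  have "a div 2 < 1 \<longleftrightarrow> a < 2" "1 \<le> a div 2 \<longleftrightarrow> 2 \<le> a" for a :: nat by presburger+
  then show ?thesis by (simp only: largest_with_mult_def count_halve_mult)
qed

lemma bij_betw_parity_split:
  "bij_betw (\<lambda>(D, P). D + P + P)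
    ({D. 0 \<notin># D \<and> distinct_parts D} \<times> {P. 0 \<notin># P}) {M. 0 \<notin># M}"
  by (rule bij_betw_byWitness[where f' = "\<lambda>M. (parity_mult M, halve_mult M)"])
    (auto simp: parity_mult_join halve_mult_join parity_halve_mult
      zero_notin_halve_mult zero_notin_parity_mult)

text \<open>The inner conjugation turns the number of parts of \<open>P\<close> into a largest part,
  which is the largest repeated part once two copies join the distinct parts \<open>D\<close>. The
  outer conjugation turns that into the number of parts above the least missing integer.\<close>

lemma bij_betw_above_missing:
  "bij_betw (\<lambda>(D, P). conj_part (D + conj_part P + conj_part P))
    ({D. 0 \<notin># D \<and> distinct_parts D} \<times> {P. 0 \<notin># P \<and> size P = j})
    {M. 0 \<notin># M \<and> num_above_missing M = j}"
proof (rule bij_betw_byWitness[where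
      f' = "\<lambda>M. (parity_mult (conj_part M), conj_part (halve_mult (conj_part M)))"])
  have fwd: "num_above_missing (conj_part (D + conj_part P + conj_part P)) = size P"
    if "0 \<notin># D" "distinct_parts D" "0 \<notin># P" for D P
  proof -
    define N where "N = D + conj_part P + conj_part P"
    have "largest_with_mult 1 (halve_mult N) (size P)"
      using largest_conj_part[OF that(3)] that by (simp add: N_def halve_mult_join)
    then have "largest_with_mult 2 N (size P)"
      by (simp only: largest_halve_mult)
    moreover have "largest_with_mult 2 N (num_above_missing (conj_part N))"
      using largest_repeated_conj_part[of "conj_part N"] that by (simp add: N_def conj_part_conj_part)
    ultimately show ?thesis
      unfolding N_def by (rule largest_with_mult_unique[symmetric])
  qed
  then show "(\<lambda>(D, P). conj_part (D + conj_part P + conj_part P)) `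
      ({D. 0 \<notin># D \<and> distinct_parts D} \<times> {P. 0 \<notin># P \<and> size P = j})
      \<subseteq> {M. 0 \<notin># M \<and> num_above_missing M = j}"
    by auto
  have bwd: "size (conj_part (halve_mult (conj_part M))) = num_above_missing M"
    if "0 \<notin># M" for M
  proof -
    define P where "P = halve_mult (conj_part M)"
    have P: "0 \<notin># P" by (simp add: P_def zero_notin_halve_mult)
    have "largest_with_mult 1 P (size (conj_part P))"
      using largest_conj_part[of "conj_part P"] P by (simp add: conj_part_conj_part)
    moreover have "largest_with_mult 1 P (num_above_missing M)"
      using largest_repeated_conj_part[of M] unfolding P_def largest_halve_mult .
    ultimately show ?thesis
      unfolding P_def by (rule largest_with_mult_unique)
  qed
  then show "(\<lambda>M. (parity_mult (conj_part M), conj_part (halve_mult (conj_part M)))) `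
      {M. 0 \<notin># M \<and> num_above_missing M = j}
      \<subseteq> {D. 0 \<notin># D \<and> distinct_parts D} \<times> {P. 0 \<notin># P \<and> size P = j}"
    by (auto simp: zero_notin_parity_mult)
qed (auto simp: conj_part_conj_part parity_mult_join halve_mult_join parity_halve_mult
    zero_notin_halve_mult zero_notin_parity_mult)

section \<open>Separating odd and even parts\<close>

definition odd_parts :: "nat multiset \<Rightarrow> nat multiset" where
  "odd_parts M = {#x \<in># M. odd x#}"

definition half_even_parts :: "nat multiset \<Rightarrow> nat multiset" where
  "half_even_parts M = image_mset (\<lambda>x. x div 2) {#x \<in># M. even x#}"

definition with_doubled :: "nat multiset \<Rightarrow> nat multiset \<Rightarrow> nat multiset" where
  "with_doubled A B = A + image_mset ((*) 2) B"

definition all_odd :: "nat multiset \<Rightarrow> bool" where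
  "all_odd M \<longleftrightarrow> (\<forall>x \<in># M. odd x)"

lemma with_doubled_split: "with_doubled (odd_parts M) (half_even_parts M) = M"
  by (induction M) (auto simp: with_doubled_def odd_parts_def half_even_parts_def)

lemma odd_parts_with_doubled: "all_odd A \<Longrightarrow> odd_parts (with_doubled A B) = A"
  by (simp add: all_odd_def with_doubled_def odd_parts_def filter_mset_image_mset filter_mset_eq_conv)

lemma half_even_parts_with_doubled:
  "all_odd A \<Longrightarrow> half_even_parts (with_doubled A B) = B"
  by (simp add: all_odd_def with_doubled_def half_even_parts_def filter_mset_image_mset multiset.map_comp o_def)

lemma sum_with_doubled [simp]: "sum_mset (with_doubled A B) = sum_mset A + 2 * sum_mset B"
  by (induction B) (auto simp: with_doubled_def)

lemma zero_notin_half_even_parts: "0 \<notin># M \<Longrightarrow> 0 \<notin># half_even_parts M"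
  by (auto simp: half_even_parts_def elim!: evenE)

lemma zero_notin_with_doubled: "0 \<notin># A \<Longrightarrow> 0 \<notin># B \<Longrightarrow> 0 \<notin># with_doubled A B"
  by (auto simp: with_doubled_def)

lemma all_odd_odd_parts: "all_odd (odd_parts M)"
  by (simp add: all_odd_def odd_parts_def)

lemma zero_notin_if_odd: "all_odd A \<Longrightarrow> 0 \<notin># A"
  unfolding all_odd_def by (metis even_zero)

lemma count_odd_parts: "count (odd_parts M) x = (if odd x then count M x else 0)"
  by (simp add: odd_parts_def)

lemma count_half_even_parts: "count (half_even_parts M) x = count M (2 * x)"
  by (induction M) (auto simp: half_even_parts_def)

lemma distinct_parts_iff:
  "distinct_parts M \<longleftrightarrow> distinct_parts (odd_parts M) \<and> distinct_parts (half_even_parts M)"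
  by (auto simp: distinct_parts_def count_odd_parts count_half_even_parts) (metis evenE)

text \<open>The conditions \<open>A\<close> and \<open>B\<close> are parameters so that one
  bijection serves Euler's theorem and both counts.\<close>

lemma bij_betw_with_doubled:
  assumes "\<And>M. Q M \<longleftrightarrow> A (odd_parts M) \<and> B (half_even_parts M)"
  shows "bij_betw (\<lambda>(X, Y). with_doubled X Y)
    ({X. all_odd X \<and> A X} \<times> {Y. 0 \<notin># Y \<and> B Y}) {M. 0 \<notin># M \<and> Q M}"
  by (rule bij_betw_byWitness[where f' = "\<lambda>M. (odd_parts M, half_even_parts M)"])
    (auto simp: assms with_doubled_split odd_parts_with_doubled half_even_parts_with_doubled
      all_odd_odd_parts zero_notin_half_even_parts zero_notin_with_doubled zero_notin_if_odd)

lemma mem_half_even_parts: "x \<in># half_even_parts M \<longleftrightarrow> 2 * x \<in># M"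
  by (simp add: count_half_even_parts flip: count_greater_zero_iff)

lemma meex_eq: "meex M = 2 * least_missing (half_even_parts M)"
  unfolding meex_def
proof (rule Least_equality)
  show "0 < 2 * least_missing (half_even_parts M) \<and> even (2 * least_missing (half_even_parts M))
      \<and> 2 * least_missing (half_even_parts M) \<notin># M"
    using least_missing_props[of "half_even_parts M"] by (simp add: mem_half_even_parts)
next
  fix k assume k: "0 < k \<and> even k \<and> k \<notin># M"
  then obtain l where "k = 2 * l" by (auto elim: evenE)
  then show "2 * least_missing (half_even_parts M) \<le> k"
    using k mem_of_less_least_missing[of l "half_even_parts M"]
    by (cases "l < least_missing (half_even_parts M)") (auto simp: mem_half_even_parts)
qed

lemma size_above_meex:
  "size {#x \<in># M. even x \<and> meex M < x#} = num_above_missing (half_even_parts M)"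
proof -
  have "size {#x \<in># M. even x \<and> 2 * m < x#} = size {#x \<in># half_even_parts M. m < x#}" for m
    by (induction M) (auto simp: half_even_parts_def elim!: evenE)
  then show ?thesis by (simp add: meex_eq num_above_missing_def)
qed

section \<open>Counting\<close>

text \<open>Restricts a bijection between families of partitions of all sizes to a single size
  \<open>n\<close>.\<close>

lemma card_weighted_eq:
  assumes "bij_betw f T X" "\<And>t. t \<in> T \<Longrightarrow> v (f t) = w t"
  shows "card {x \<in> X. v x = n} = card {t \<in> T. w t = n}"
proof -
  have "bij_betw f {t \<in> T. w t = n} {x \<in> X. v x = n}"
    using assms unfolding bij_betw_def by (auto simp: inj_on_def)
  then show ?thesis by (simp add: bij_betw_same_card)
qed

lemma finite_partitions_le:
  fixes n c :: nat
  assumes "B \<subseteq> {P. 0 \<notin># P}" "0 < c"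
  shows "finite {P \<in> B. c * sum_mset P \<le> n}"
proof (rule finite_subset)
  show "{P \<in> B. c * sum_mset P \<le> n} \<subseteq> (\<Union>k\<le>n. {P. is_partition P k})"
  proof
    fix P assume P: "P \<in> {P \<in> B. c * sum_mset P \<le> n}"
    have "1 * sum_mset P \<le> c * sum_mset P" using assms(2) by (intro mult_right_mono) auto
    with P have "sum_mset P \<le> n" by (metis (mono_tags) le_trans mem_Collect_eq mult_1)
    then show "P \<in> (\<Union>k\<le>n. {P. is_partition P k})"
      using P assms(1) by (auto simp: is_partition_def)
  qed
qed (simp add: finite_partitions)

lemma card_pairs:
  fixes n c :: nat
  assumes "A \<subseteq> {P. 0 \<notin># P}" "B \<subseteq> {P. 0 \<notin># P}" "0 < c"
  shows "card {t \<in> A \<times> B. sum_mset (fst t) + c * sum_mset (snd t) = n}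
    = (\<Sum>P\<in>{P \<in> B. c * sum_mset P \<le> n}. card {D \<in> A. sum_mset D = n - c * sum_mset P})"
proof -
  \<comment> \<open>\<open>P\<close> comes first because the fibre depends on it; the bound on
    \<open>P\<close> makes the truncated subtraction exact.\<close>
  let ?S = "SIGMA P:{P \<in> B. c * sum_mset P \<le> n}. {D \<in> A. sum_mset D = n - c * sum_mset P}"
  have "bij_betw prod.swap ?S {t \<in> A \<times> B. sum_mset (fst t) + c * sum_mset (snd t) = n}"
    by (rule bij_betw_byWitness[where f' = prod.swap]) (auto simp flip: sum_mset_distrib_left)
  then have "card {t \<in> A \<times> B. sum_mset (fst t) + c * sum_mset (snd t) = n} = card ?S"
    by (simp add: bij_betw_same_card)
  also have "\<dots> = (\<Sum>P\<in>{P \<in> B. c * sum_mset P \<le> n}. card {D \<in> A. sum_mset D = n - c * sum_mset P})"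
  proof (rule card_SigmaI)
    show "finite {P \<in> B. c * sum_mset P \<le> n}"
      by (rule finite_partitions_le[OF assms(2,3)])
    have "finite {D \<in> A. sum_mset D = k}" for k
      by (rule finite_subset[OF _ finite_partitions[of k]]) (use assms(1) in \<open>auto simp: is_partition_def\<close>)
    then show "\<forall>P\<in>{P \<in> B. c * sum_mset P \<le> n}. finite {D \<in> A. sum_mset D = n - c * sum_mset P}"
      by blast
  qed
  finally show ?thesis .
qed

text \<open>Both splittings of an arbitrary partition, by the parity of the multiplicities and by the
  parity of the parts, leave twice an arbitrary partition as the second component. Cancelling it
  from the two convolutions gives Euler's theorem.\<close>

lemma euler_odd_distinct:
  "card {D \<in> {D. 0 \<notin># D \<and> distinct_parts D}. sum_mset D = n}
    = card {D \<in> {D. all_odd D}. sum_mset D = n}"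
  (is "?d n = ?o n")
proof (induction n rule: less_induct)
  case (less n)
  let ?P = "{P. 0 \<notin># P} :: nat multiset set"
  let ?I = "{P \<in> ?P. 2 * sum_mset P \<le> n}"
  have "card {M \<in> ?P. sum_mset M = n}
      = card {t \<in> {D. 0 \<notin># D \<and> distinct_parts D} \<times> ?P. sum_mset (fst t) + 2 * sum_mset (snd t) = n}"
    by (rule card_weighted_eq[OF bij_betw_parity_split]) auto
  also have "\<dots> = (\<Sum>P\<in>?I. ?d (n - 2 * sum_mset P))"
    by (rule card_pairs) auto
  finally have d: "card {M \<in> ?P. sum_mset M = n} = (\<Sum>P\<in>?I. ?d (n - 2 * sum_mset P))" .
  have bij: "bij_betw (\<lambda>(X, Y). with_doubled X Y) ({X. all_odd X} \<times> ?P) ?P"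
    using bij_betw_with_doubled[of "\<lambda>_. True" "\<lambda>_. True" "\<lambda>_. True"] by simp
  have "card {M \<in> ?P. sum_mset M = n}
      = card {t \<in> {X. all_odd X} \<times> ?P. sum_mset (fst t) + 2 * sum_mset (snd t) = n}"
    by (rule card_weighted_eq[OF bij]) (simp only: case_prod_beta sum_with_doubled)
  also have "\<dots> = (\<Sum>P\<in>?I. ?o (n - 2 * sum_mset P))"
    by (rule card_pairs) (auto simp: zero_notin_if_odd)
  finally have o: "card {M \<in> ?P. sum_mset M = n} = (\<Sum>P\<in>?I. ?o (n - 2 * sum_mset P))" .
  have fin: "finite ?I" by (rule finite_partitions_le) auto
  \<comment> \<open>A nonempty \<open>P\<close> has positive sum, so the argument drops below
    \<open>n\<close> and the induction hypothesis applies.\<close>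
  have rest: "(\<Sum>P\<in>?I - {{#}}. ?d (n - 2 * sum_mset P)) = (\<Sum>P\<in>?I - {{#}}. ?o (n - 2 * sum_mset P))"
  proof (rule sum.cong[OF refl])
    fix P assume P: "P \<in> ?I - {{#}}"
    then obtain x where x: "x \<in># P" by (metis DiffE multiset_nonemptyE singletonI)
    with P have "x \<noteq> 0" by (cases "x = 0") auto
    then have "0 < sum_mset P" using le_sum_mset[OF x] by simp
    then show "?d (n - 2 * sum_mset P) = ?o (n - 2 * sum_mset P)"
      using P by (intro less.IH) auto
  qed
  \<comment> \<open>The empty partition contributes the terms at \<open>n\<close> itself, the two
    numbers to be compared.\<close>
  have "{#} \<in> ?I" by simp
  then have "?d n + (\<Sum>P\<in>?I - {{#}}. ?d (n - 2 * sum_mset P))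
      = ?o n + (\<Sum>P\<in>?I - {{#}}. ?o (n - 2 * sum_mset P))"
    using d o sum.remove[OF fin, of "{#}" "\<lambda>P. ?d (n - 2 * sum_mset P)"]
      sum.remove[OF fin, of "{#}" "\<lambda>P. ?o (n - 2 * sum_mset P)"] by simp
  with rest show ?case by simp
qed

text \<open>The halved even parts become a pair \<open>(D, P)\<close> of weight
  \<open>2 * (|D| + 2 * |P|)\<close>. The doubled parts of \<open>D\<close> then rejoin the distinct
  odd parts, which leaves weight \<open>4 * |P|\<close> for \<open>P\<close>.\<close>

lemma card_od_e:
  "p_od_e n j = card {t \<in> {D. 0 \<notin># D \<and> distinct_parts D} \<times> {P. 0 \<notin># P \<and> size P = j}.
    sum_mset (fst t) + 4 * sum_mset (snd t) = n}"
proof -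
  let ?O = "{X. all_odd X \<and> distinct_parts X}"
  let ?D = "{D. 0 \<notin># D \<and> distinct_parts D}"
  let ?P = "{P. 0 \<notin># P \<and> size P = j}"
  let ?Q = "\<lambda>M. distinct_parts (odd_parts M) \<and> num_above_missing (half_even_parts M) = j"
  have odd_distinct: "(\<forall>x. odd x \<longrightarrow> count M x \<le> 1) \<longleftrightarrow> distinct_parts (odd_parts M)" for M
    by (auto simp: distinct_parts_def count_odd_parts)
  have "p_od_e n j = card {M \<in> {M. 0 \<notin># M \<and> ?Q M}. sum_mset M = n}"
    unfolding p_od_e_def is_partition_def size_above_meex odd_distinct
    by (rule arg_cong[of _ _ card]) auto
  also have "\<dots> = card {t \<in> ?O \<times> {M. 0 \<notin># M \<and> num_above_missing M = j}.
      sum_mset (fst t) + 2 * sum_mset (snd t) = n}"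
    by (rule card_weighted_eq[OF bij_betw_with_doubled]) auto
  also have "\<dots> = card {t \<in> ?O \<times> ?D \<times> ?P.
      sum_mset (fst t) + 2 * (sum_mset (fst (snd t)) + 2 * sum_mset (snd (snd t))) = n}"
    by (rule card_weighted_eq[OF bij_betw_map_prod[OF bij_betw_id bij_betw_above_missing]]) auto
  also have "\<dots> = card {t \<in> (?O \<times> ?D) \<times> ?P.
      sum_mset (fst (fst t)) + 2 * (sum_mset (snd (fst t)) + 2 * sum_mset (snd t)) = n}"
    by (rule card_weighted_eq[where f = "\<lambda>((X, D), P). (X, D, P)"])
      (auto intro!: bij_betw_byWitness[where f' = "\<lambda>(X, D, P). ((X, D), P)"])
  \<comment> \<open>Read from right to left: a partition into distinct parts splits into distinct
    odd parts and the doubles of distinct parts, by \<open>distinct_parts_iff\<close>.\<close>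
  also have "\<dots> = card {t \<in> ?D \<times> ?P. sum_mset (fst t) + 4 * sum_mset (snd t) = n}"
    by (rule card_weighted_eq[symmetric, OF bij_betw_map_prod[OF bij_betw_with_doubled bij_betw_id]])
      (auto simp: distinct_parts_iff[symmetric])
  finally show ?thesis .
qed

text \<open>An even part is a multiple of 4 exactly when its half is even, so the even parts can be
  halved twice; this preserves their number and divides their sum by 4.\<close>

lemma card_4_e:
  "p_4_e n j = card {t \<in> {X. all_odd X} \<times> {P. 0 \<notin># P \<and> size P = j}.
    sum_mset (fst t) + 4 * sum_mset (snd t) = n}"
proof -
  let ?P = "{P. 0 \<notin># P \<and> size P = j}"
  let ?B = "\<lambda>Y. (\<forall>x \<in># Y. even x) \<and> size Y = j"
  have four: "(\<forall>x. x \<in># M \<longrightarrow> even x \<longrightarrow> 4 dvd x) \<longleftrightarrow> (\<forall>x \<in># half_even_parts M. even x)" for M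
  proof -
    have "4 dvd 2 * x \<longleftrightarrow> even x" for x :: nat by presburger
    then show ?thesis by (auto simp: mem_half_even_parts elim!: evenE)
  qed
  have size: "size {#x \<in># M. even x#} = size (half_even_parts M)" for M
    by (simp add: half_even_parts_def)
  have nonzero: False if "x \<in># Y" "0 \<notin># Y" "\<forall>x \<in># Y. even x" "x div 2 = 0" for x :: nat and Y
    using that by (metis dvd_mult_div_cancel mult_0_right)
  have bij: "bij_betw (image_mset ((*) 2)) ?P {Y :: nat multiset. 0 \<notin># Y \<and> ?B Y}"
    by (rule bij_betw_byWitness[where f' = "image_mset (\<lambda>x. x div 2)"])
      (auto simp: multiset.map_comp o_def intro!: multiset.map_ident_strong, rule nonzero)
  have "p_4_e n j = card {M \<in> {M. 0 \<notin># M \<and> ?B (half_even_parts M)}. sum_mset M = n}"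
    unfolding p_4_e_def is_partition_def four size
    by (rule arg_cong[of _ _ card]) auto
  \<comment> \<open>The conjunct \<open>True\<close> is the trivial condition \<open>A\<close> in
    \<open>bij_betw_with_doubled\<close>.\<close>
  also have "\<dots> = card {t \<in> {X. all_odd X \<and> True} \<times> {Y. 0 \<notin># Y \<and> ?B Y}.
      sum_mset (fst t) + 2 * sum_mset (snd t) = n}"
    by (rule card_weighted_eq[OF bij_betw_with_doubled]) auto
  also have "\<dots> = card {t \<in> {X. all_odd X \<and> True} \<times> ?P.
      sum_mset (fst t) + 4 * sum_mset (snd t) = n}"
    by (rule card_weighted_eq[OF bij_betw_map_prod[OF bij_betw_id bij]])
      (auto simp: sum_mset_distrib_left[symmetric])
  finally show ?thesis by simp
qed

theorem theorem1p8:
  fixes n j :: nat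
  shows "p_od_e n j = p_4_e n j"
proof -
  let ?P = "{P. 0 \<notin># P \<and> size P = j} :: nat multiset set"
  have "p_od_e n j = (\<Sum>P\<in>{P \<in> ?P. 4 * sum_mset P \<le> n}.
      card {D \<in> {D. 0 \<notin># D \<and> distinct_parts D}. sum_mset D = n - 4 * sum_mset P})"
    unfolding card_od_e by (rule card_pairs) auto
  \<comment> \<open>Both counts are sums over the same \<open>P\<close>, so Euler's theorem applies
    term by term.\<close>
  also have "\<dots> = (\<Sum>P\<in>{P \<in> ?P. 4 * sum_mset P \<le> n}.
      card {D \<in> {D. all_odd D}. sum_mset D = n - 4 * sum_mset P})"
    by (simp only: euler_odd_distinct)
  also have "\<dots> = p_4_e n j"
    unfolding card_4_e by (rule card_pairs[symmetric]) (auto simp: zero_notin_if_odd)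
  finally show ?thesis .
qed

end
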